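(* The class of well-ve-dominated graphs, or equivalently, the class of well-isolated graphs, is not hereditary; that is, it is not closed under taking induced subgraphs.
   Context: All graphs are finite, simple and undirected. A vertex $v$ ve-dominates an edge $e$ if at least one endpoint of $e$ belongs to the closed neighborhood $N_G[v]$. A set $D\subseteq V(G)$ is a ve-dominating set if every edge of $G$ is ve-dominated by some vertex of $D$; it is minimal if no proper subset is ve-dominating. $G$ is well-ve-dominated if all its minimal ve-dominating sets have the same cardinality. A set $D\subseteq V(G)$ is an isolating set if $G-N_G[D]$ has no edges, where $N_G[D]=\bigcup_{v\in D}N_G[v]$; $G$ is well-isolated if all its (inclusion-)minimal isolating sets have the same cardinality. *)

theory Defs
  imports "Graph_Theory.Digraph_Component"
begin

text \<open>
  Finite simple undirected graphs are the members of the locale \<^locale>\<open>graph\<close>: finite, loop-free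
  symmetric digraphs without parallel arcs. An undirected edge \<open>uv\<close> corresponds to the two arcs
  \<open>(u, v)\<close> and \<open>(v, u)\<close>; \<open>edges G\<close> collapses each such pair to the set \<open>{u, v}\<close>.
\<close>

definition edges :: "('a, 'b) pre_digraph \<Rightarrow> 'a set set" where
  "edges G = {{u, v} | u v. u \<rightarrow>\<^bsub>G\<^esub> v}"

definition closed_nbhd :: "('a, 'b) pre_digraph \<Rightarrow> 'a \<Rightarrow> 'a set" where
  "closed_nbhd G v = insert v {u \<in> verts G. v \<rightarrow>\<^bsub>G\<^esub> u}"

definition ve_dominates :: "('a, 'b) pre_digraph \<Rightarrow> 'a \<Rightarrow> 'a set \<Rightarrow> bool" where
  "ve_dominates G v e \<longleftrightarrow> (\<exists>x \<in> e. x \<in> closed_nbhd G v)"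

definition ve_dominating_set :: "('a, 'b) pre_digraph \<Rightarrow> 'a set \<Rightarrow> bool" where
  "ve_dominating_set G D \<longleftrightarrow> D \<subseteq> verts G \<and> (\<forall>e \<in> edges G. \<exists>v \<in> D. ve_dominates G v e)"

definition minimal_ve_dominating_set :: "('a, 'b) pre_digraph \<Rightarrow> 'a set \<Rightarrow> bool" where
  "minimal_ve_dominating_set G D \<longleftrightarrow>
     ve_dominating_set G D \<and> (\<forall>D'. D' \<subset> D \<longrightarrow> \<not> ve_dominating_set G D')"

definition well_ve_dominated :: "('a, 'b) pre_digraph \<Rightarrow> bool" where
  "well_ve_dominated G \<longleftrightarrow>
     (\<forall>D D'. minimal_ve_dominating_set G D \<and> minimal_ve_dominating_set G D' \<longrightarrow> card D = card D')"

definition isolating_set :: "('a, 'b) pre_digraph \<Rightarrow> 'a set \<Rightarrow> bool" where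
  "isolating_set G D \<longleftrightarrow>
     D \<subseteq> verts G \<and> edges (G \<restriction> (verts G - (\<Union>v \<in> D. closed_nbhd G v))) = {}"

definition minimal_isolating_set :: "('a, 'b) pre_digraph \<Rightarrow> 'a set \<Rightarrow> bool" where
  "minimal_isolating_set G D \<longleftrightarrow>
     isolating_set G D \<and> (\<forall>D'. D' \<subset> D \<longrightarrow> \<not> isolating_set G D')"

definition well_isolated :: "('a, 'b) pre_digraph \<Rightarrow> bool" where
  "well_isolated G \<longleftrightarrow>
     (\<forall>D D'. minimal_isolating_set G D \<and> minimal_isolating_set G D' \<longrightarrow> card D = card D')"

definition hereditary :: "('a, 'b) pre_digraph set \<Rightarrow> bool" where
  "hereditary \<C> \<longleftrightarrow> (\<forall>G \<in> \<C>. \<forall>H. induced_subgraph H G \<longrightarrow> H \<in> \<C>)"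

end

theory Submission
  imports Defs
begin

text \<open>
  The two notions of well-behaved graph agree because the two kinds of sets agree: an edge survives
  in \<open>G - N[D]\<close> exactly when neither of its endpoints lies in the closed neighbourhood of a
  vertex of \<open>D\<close>, that is, when no vertex of \<open>D\<close> ve-dominates it.

  The counterexample to heredity is the 5-cycle. Each of its vertices ve-dominates every edge except
  the one opposite to it, and distinct vertices have distinct opposite edges. Hence no single vertex
  ve-dominates the cycle while any two do, so every minimal ve-dominating set has exactly two
  elements. Deleting one vertex leaves the path \<open>0 - 1 - 2 - 3\<close>, in which the inner vertex \<open>1\<close>
  ve-dominates every edge, whereas the two ends \<open>0\<close> and \<open>3\<close> form a minimal ve-dominating set of
  size two: neither end reaches the edge at the opposite end.
\<close>

lemma (in wf_digraph) ve_dominates_arc_iff: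
  assumes "u \<rightarrow> v"
  shows "ve_dominates G w {u, v} \<longleftrightarrow> w = u \<or> w = v \<or> w \<rightarrow> u \<or> w \<rightarrow> v"
  using assms adj_in_verts unfolding ve_dominates_def closed_nbhd_def by auto

lemma ball_edges_iff: "(\<forall>e\<in>edges G. P e) \<longleftrightarrow> (\<forall>u v. u \<rightarrow>\<^bsub>G\<^esub> v \<longrightarrow> P {u, v})"
  unfolding edges_def by blast

lemma (in wf_digraph) ve_dominating_set_iff:
  "ve_dominating_set G D \<longleftrightarrow>
     D \<subseteq> verts G \<and> (\<forall>u v. u \<rightarrow> v \<longrightarrow> (\<exists>w\<in>D. w = u \<or> w = v \<or> w \<rightarrow> u \<or> w \<rightarrow> v))"
  by (simp add: ve_dominating_set_def ball_edges_iff ve_dominates_arc_iff)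

lemma dominates_induce_subgraph_iff:
  "u \<rightarrow>\<^bsub>G \<restriction> S\<^esub> v \<longleftrightarrow> u \<rightarrow>\<^bsub>G\<^esub> v \<and> u \<in> S \<and> v \<in> S"
  by (auto simp: arcs_ends_def arc_to_ends_def)

text \<open>
  Both conditions say that the union of the closed neighbourhoods of \<open>D\<close> meets every edge. Since
  the two families of sets coincide, so do their minimal members and the two classes of graphs.
\<close>

lemma (in wf_digraph) isolating_set_iff_ve_dominating_set:
  "isolating_set G D \<longleftrightarrow> ve_dominating_set G D"
proof -
  define N where "N = (\<Union>w\<in>D. closed_nbhd G w)"
  have "edges (G \<restriction> (verts G - N)) = {} \<longleftrightarrow> (\<forall>u v. u \<rightarrow>\<^bsub>G\<^esub> v \<longrightarrow> u \<in> N \<or> v \<in> N)"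
    unfolding edges_def dominates_induce_subgraph_iff by (auto dest: adj_in_verts)
  also have "\<dots> \<longleftrightarrow> (\<forall>e\<in>edges G. \<exists>w\<in>D. ve_dominates G w e)"
    by (simp add: ball_edges_iff ve_dominates_def N_def bex_disj_distrib)
  finally show ?thesis
    by (simp add: isolating_set_def N_def ve_dominating_set_def)
qed

lemma (in wf_digraph) well_ve_dominated_iff_well_isolated:
  "well_ve_dominated G \<longleftrightarrow> well_isolated G"
  unfolding well_ve_dominated_def well_isolated_def minimal_ve_dominating_set_def
    minimal_isolating_set_def isolating_set_iff_ve_dominating_set ..

definition cycle5 :: "(nat, nat \<times> nat) pre_digraph" where
  "cycle5 = \<lparr>verts = {0, 1, 2, 3, 4},
     arcs = {(0, 1), (1, 2), (2, 3), (3, 4), (4, 0), (1, 0), (2, 1), (3, 2), (4, 3), (0, 4)},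
     tail = fst, head = snd\<rparr>"

lemma verts_cycle5: "verts cycle5 = {0, 1, 2, 3, 4}"
  by (simp add: cycle5_def)

lemma dominates_cycle5_iff:
  "u \<rightarrow>\<^bsub>cycle5\<^esub> v \<longleftrightarrow>
     (u, v) \<in> {(0, 1), (1, 2), (2, 3), (3, 4), (4, 0), (1, 0), (2, 1), (3, 2), (4, 3), (0, 4)}"
  by (simp add: cycle5_def arcs_ends_def arc_to_ends_def)

interpretation cycle5: graph cycle5
proof
  show "symmetric cycle5"
    unfolding symmetric_def sym_def dominates_cycle5_iff by simp
qed (auto simp: cycle5_def arc_to_ends_def)

lemma singleton_not_ve_dominating_cycle5: "\<not> ve_dominating_set cycle5 {w}"
proof
  assume "ve_dominating_set cycle5 {w}"
  then have dom: "u \<rightarrow>\<^bsub>cycle5\<^esub> v \<Longrightarrow> w = u \<or> w = v \<or> w \<rightarrow>\<^bsub>cycle5\<^esub> u \<or> w \<rightarrow>\<^bsub>cycle5\<^esub> v"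
    and w: "w \<in> verts cycle5" for u v
    by (simp_all add: cycle5.ve_dominating_set_iff)
  from w consider "w = 0" | "w = 1" | "w = 2" | "w = 3" | "w = 4"
    unfolding verts_cycle5 by blast
  then show False
    \<comment> \<open>In each case one of the five edges is opposite to \<open>w\<close>.\<close>
    using dom[of 0 1] dom[of 1 2] dom[of 2 3] dom[of 3 4] dom[of 4 0]
    by cases (simp_all add: dominates_cycle5_iff)
qed

text \<open>
  The vertex opposite to the edge \<open>{i, i + 1}\<close> is \<open>i + 3\<close>, and \<open>3 (u + v)\<close> is an expression for it
  that does not depend on the orientation of the edge, because \<open>3 (2 i + 1) = i + 3\<close> modulo 5.
\<close>

lemma non_opposite_dominates_cycle5:
  assumes "u \<rightarrow>\<^bsub>cycle5\<^esub> v" "w \<in> verts cycle5" "w \<noteq> 3 * (u + v) mod 5"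
  shows "w = u \<or> w = v \<or> w \<rightarrow>\<^bsub>cycle5\<^esub> u \<or> w \<rightarrow>\<^bsub>cycle5\<^esub> v"
  using assms unfolding dominates_cycle5_iff verts_cycle5
  by (elim insertE emptyE) simp_all

text \<open>Two distinct vertices cannot both be opposite to the same edge.\<close>

lemma pair_ve_dominating_cycle5:
  assumes "x \<in> verts cycle5" "y \<in> verts cycle5" "x \<noteq> y"
  shows "ve_dominating_set cycle5 {x, y}"
  unfolding cycle5.ve_dominating_set_iff
  using assms non_opposite_dominates_cycle5 by (metis empty_subsetI insertCI insert_subset)

text \<open>
  A ve-dominating set has at least two elements, and any two of them already ve-dominate, so by
  minimality there are no others.
\<close>

lemma card_minimal_ve_dominating_set_cycle5:
  assumes "minimal_ve_dominating_set cycle5 D"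
  shows "card D = 2"
proof -
  have D: "ve_dominating_set cycle5 D" and min: "D' \<subset> D \<Longrightarrow> \<not> ve_dominating_set cycle5 D'" for D'
    using assms by (auto simp: minimal_ve_dominating_set_def)
  have sub: "D \<subseteq> verts cycle5"
    using D by (simp add: ve_dominating_set_def)
  have "\<not> ve_dominating_set cycle5 {}"
    using dominates_cycle5_iff[of 0 1] by (auto simp: cycle5.ve_dominating_set_iff)
  then obtain x where x: "x \<in> D"
    using D by (cases "D = {}") auto
  moreover have "D \<noteq> {x}"
    using D singleton_not_ve_dominating_cycle5 by metis
  ultimately obtain y where y: "y \<in> D" "x \<noteq> y"
    by blast
  have "ve_dominating_set cycle5 {x, y}"
    using pair_ve_dominating_cycle5 sub x y by blast
  then have "D = {x, y}"
    using min[of "{x, y}"] x y by blast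
  then show ?thesis
    using y by simp
qed

lemma well_ve_dominated_cycle5: "well_ve_dominated cycle5"
  by (simp add: well_ve_dominated_def card_minimal_ve_dominating_set_cycle5)

abbreviation path4 :: "(nat, nat \<times> nat) pre_digraph" where
  "path4 \<equiv> cycle5 \<restriction> {0, 1, 2, 3}"

lemma induced_path4: "induced_subgraph path4 cycle5"
  by (rule cycle5.induced_induce) (simp add: verts_cycle5)

lemma dominates_path4_iff:
  "u \<rightarrow>\<^bsub>path4\<^esub> v \<longleftrightarrow> (u, v) \<in> {(0, 1), (1, 2), (2, 3), (1, 0), (2, 1), (3, 2)}"
  unfolding dominates_induce_subgraph_iff dominates_cycle5_iff by auto

interpretation path4: wf_digraph path4
  by (rule cycle5.wellformed_induce_subgraph)

lemma path4_minimal_inner: "minimal_ve_dominating_set path4 {1}"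
  unfolding minimal_ve_dominating_set_def path4.ve_dominating_set_iff dominates_path4_iff
  by (auto simp: psubset_insert_iff)

lemma path4_minimal_ends: "minimal_ve_dominating_set path4 {0, 3}"
proof -
  have "\<not> ve_dominating_set path4 D" if D: "D \<subset> {0, 3}" for D
  proof
    assume "ve_dominating_set path4 D"
    then have "\<exists>w\<in>D. w = u \<or> w = v \<or> w \<rightarrow>\<^bsub>path4\<^esub> u \<or> w \<rightarrow>\<^bsub>path4\<^esub> v" if "u \<rightarrow>\<^bsub>path4\<^esub> v" for u v
      using that unfolding path4.ve_dominating_set_iff by blast
    \<comment> \<open>The first end edge is out of reach of \<open>3\<close> and the last one is out of reach of \<open>0\<close>.\<close>
    from this[of 0 1] this[of 2 3]
    have "\<exists>w\<in>D. w \<in> {0, 1, 2}" "\<exists>w\<in>D. w \<in> {1, 2, 3}"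
      unfolding dominates_path4_iff by auto
    then show False
      using D by fastforce
  qed
  moreover have "ve_dominating_set path4 {0, 3}"
    unfolding path4.ve_dominating_set_iff dominates_path4_iff by auto
  ultimately show ?thesis
    by (simp add: minimal_ve_dominating_set_def)
qed

lemma not_well_ve_dominated_path4: "\<not> well_ve_dominated path4"
proof
  assume "well_ve_dominated path4"
  then have "card {1 :: nat} = card {0 :: nat, 3}"
    using path4_minimal_inner path4_minimal_ends unfolding well_ve_dominated_def by blast
  then show False
    by simp
qed

theorem proposition4:
  shows "(\<forall>G :: ('a, 'b) pre_digraph. graph G \<longrightarrow> (well_ve_dominated G \<longleftrightarrow> well_isolated G)) \<and>
    \<not> hereditary {G :: (nat, nat \<times> nat) pre_digraph. graph G \<and> well_ve_dominated G} \<and>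
    \<not> hereditary {G :: (nat, nat \<times> nat) pre_digraph. graph G \<and> well_isolated G}"
proof (intro conjI allI impI)
  fix G :: "('a, 'b) pre_digraph"
  assume "graph G"
  then interpret graph G .
  show "well_ve_dominated G \<longleftrightarrow> well_isolated G"
    by (rule well_ve_dominated_iff_well_isolated)
next
  show "\<not> hereditary {G :: (nat, nat \<times> nat) pre_digraph. graph G \<and> well_ve_dominated G}"
    using cycle5.graph_axioms well_ve_dominated_cycle5 induced_path4 not_well_ve_dominated_path4
    unfolding hereditary_def by blast
next
  show "\<not> hereditary {G :: (nat, nat \<times> nat) pre_digraph. graph G \<and> well_isolated G}"
    using cycle5.graph_axioms well_ve_dominated_cycle5 induced_path4 not_well_ve_dominated_path4
    unfolding hereditary_def cycle5.well_ve_dominated_iff_well_isolated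
      path4.well_ve_dominated_iff_well_isolated by blast
qed

end
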